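(* Let $(T_n)_{n\ge 1}$ be a perturbed random walk which is negatively divergent, and let $x\in\mathbb{R}$. Then $\tau(x)<\infty$ a.s. if and only if $\mathbb{P}\{\xi<0,\ \eta\le x\}=0$. Furthermore, $\mathbb{P}\{\eta\le x\}<1$ holds true in this case.
   Context: Let $(\xi,\eta),(\xi_1,\eta_1),(\xi_2,\eta_2),\ldots$ be i.i.d. $\mathbb{R}^2$-valued random vectors; no condition is imposed on the dependence between $\xi$ and $\eta$. Put $S_0:=0$, $S_n:=\xi_1+\cdots+\xi_n$ for $n\in\mathbb{N}=\{1,2,\ldots\}$, and $T_n:=S_{n-1}+\eta_n$ for $n\in\mathbb{N}$; $(T_n)_{n\ge1}$ is called a perturbed random walk. Standing assumption: $\mathbb{P}\{\xi=0\}<1$ and $\mathbb{P}\{\eta=0\}<1$. The perturbed random walk is called negatively divergent if $\lim_{n\to\infty}T_n=-\infty$ a.s. For $x\in\mathbb{R}$, $\tau(x):=\inf\{n\in\mathbb{N}:T_n>x\}$, with $\inf\emptyset:=\infty$. *)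

theory Defs
  imports "HOL-Probability.Probability" "HOL-Library.Extended_Nat"
begin

text \<open>
  The family \<open>(\<xi>, \<eta>), (\<xi>\<^sub>1, \<eta>\<^sub>1), (\<xi>\<^sub>2, \<eta>\<^sub>2), \<dots>\<close>, with the generic pair stored at index 0.
  The values of the sequences at index 0 are irrelevant.
\<close>
definition pair_family ::
  "('a \<Rightarrow> real) \<Rightarrow> ('a \<Rightarrow> real) \<Rightarrow> (nat \<Rightarrow> 'a \<Rightarrow> real) \<Rightarrow> (nat \<Rightarrow> 'a \<Rightarrow> real) \<Rightarrow> nat \<Rightarrow> 'a \<Rightarrow> real \<times> real"
  where "pair_family \<xi> \<eta> \<xi>s \<eta>s n =
    (if n = 0 then (\<lambda>\<omega>. (\<xi> \<omega>, \<eta> \<omega>)) else (\<lambda>\<omega>. (\<xi>s n \<omega>, \<eta>s n \<omega>)))"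

text \<open>
  Independence is between the pairs only; the two components of a pair may be arbitrarily
  dependent. \<^const>\<open>prob_space.indep_vars\<close> includes measurability of the pairs.
\<close>
locale perturbed_random_walk = prob_space M for M :: "'a measure" +
  fixes \<xi> \<eta> :: "'a \<Rightarrow> real" and \<xi>s \<eta>s :: "nat \<Rightarrow> 'a \<Rightarrow> real"
  assumes indep: "indep_vars (\<lambda>_. borel) (pair_family \<xi> \<eta> \<xi>s \<eta>s) UNIV"
    and ident_distr: "\<And>n. n \<ge> 1 \<Longrightarrow>
      distr M borel (\<lambda>\<omega>. (\<xi>s n \<omega>, \<eta>s n \<omega>)) = distr M borel (\<lambda>\<omega>. (\<xi> \<omega>, \<eta> \<omega>))"
    and xi_nonzero: "prob {\<omega> \<in> space M. \<xi> \<omega> = 0} < 1"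
    and eta_nonzero: "prob {\<omega> \<in> space M. \<eta> \<omega> = 0} < 1"

definition walk :: "(nat \<Rightarrow> 'a \<Rightarrow> real) \<Rightarrow> nat \<Rightarrow> 'a \<Rightarrow> real"
  where "walk \<xi>s n \<omega> = (\<Sum>k=1..n. \<xi>s k \<omega>)"

text \<open>Only the values for \<open>n \<ge> 1\<close> are meaningful.\<close>
definition perturbed_walk :: "(nat \<Rightarrow> 'a \<Rightarrow> real) \<Rightarrow> (nat \<Rightarrow> 'a \<Rightarrow> real) \<Rightarrow> nat \<Rightarrow> 'a \<Rightarrow> real"
  where "perturbed_walk \<xi>s \<eta>s n \<omega> = walk \<xi>s (n - 1) \<omega> + \<eta>s n \<omega>"

definition negatively_divergent :: "'a measure \<Rightarrow> (nat \<Rightarrow> 'a \<Rightarrow> real) \<Rightarrow> bool"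
  where "negatively_divergent M T \<longleftrightarrow> (AE \<omega> in M. filterlim (\<lambda>n. T n \<omega>) at_bot sequentially)"

text \<open>In \<^typ>\<open>enat\<close> the infimum of the empty set is \<open>\<infinity>\<close>.\<close>
definition first_passage :: "(nat \<Rightarrow> 'a \<Rightarrow> real) \<Rightarrow> real \<Rightarrow> 'a \<Rightarrow> enat"
  where "first_passage T x \<omega> = Inf {enat n | n. n \<ge> 1 \<and> T n \<omega> > x}"

end

theory Submission
  imports Defs
begin

text \<open>
  If \<open>\<xi> < 0\<close> and \<open>\<eta> \<le> x\<close> has positive probability, then so has \<open>\<xi> < - c\<close> and \<open>\<eta> \<le> x\<close> for some
  \<open>c > 0\<close>. Negative divergence gives \<open>sup T\<^sub>n \<le> L\<close> with positive probability for some \<open>L\<close>; prepending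
  one step from that event lowers the bound from \<open>L\<close> to \<open>max x (L - c)\<close>, so after finitely many
  steps \<open>sup T\<^sub>n \<le> x\<close> has positive probability.

  Conversely, if \<open>\<xi> < 0\<close> forces \<open>\<eta> > x\<close>, then on \<open>\<tau>(x) = \<infinity>\<close> an induction on \<open>n\<close> shows
  \<open>\<xi>\<^sub>n \<ge> 0\<close> and \<open>\<eta>\<^sub>n \<le> x\<close> for all \<open>n\<close>. This has positive probability only if \<open>\<xi> \<ge> 0\<close> almost surely;
  but then \<open>T\<^sub>n \<ge> \<eta>\<^sub>n\<close>, and an i.i.d. sequence does not tend to \<open>-\<infinity>\<close>.
\<close>

section \<open>Pathwise facts about perturbed walks\<close>

definition path_value :: "(nat \<Rightarrow> real \<times> real) \<Rightarrow> nat \<Rightarrow> real"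
  where "path_value w n = (\<Sum>k<n. fst (w k)) + snd (w n)"

lemma path_value_case_nat_0 [simp]: "path_value (case_nat s w) 0 = snd s"
  by (simp add: path_value_def)

text \<open>First-step decomposition: behind a prepended pair the old path reappears, shifted by one
  index and by the first component of that pair.\<close>

lemma path_value_case_nat_Suc [simp]:
  "path_value (case_nat s w) (Suc n) = fst s + path_value w n"
  unfolding path_value_def by (subst sum.lessThan_Suc_shift) simp

lemma perturbed_walk_Suc:
  "perturbed_walk \<xi>s \<eta>s (Suc n) \<omega> = path_value (\<lambda>k. (\<xi>s (Suc k) \<omega>, \<eta>s (Suc k) \<omega>)) n"
  unfolding perturbed_walk_def walk_def path_value_def
  using sum.atLeast1_atMost_eq[of "\<lambda>k. \<xi>s k \<omega>" n] by simp

lemma first_passage_finite_iff: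
  "first_passage T x \<omega> < \<infinity> \<longleftrightarrow> (\<exists>n. T (Suc n) \<omega> > x)"
proof -
  have "first_passage T x \<omega> < \<infinity> \<longleftrightarrow> (\<exists>n\<ge>1. T n \<omega> > x)"
    unfolding first_passage_def Inf_less_iff by auto
  then show ?thesis
    by (metis Suc_le_D One_nat_def le_add1 plus_1_eq_Suc)
qed

text \<open>Only countable quantifiers remain on the right, which makes divergence a measurable
  event of the path.\<close>

lemma filterlim_at_bot_iff_nat:
  fixes f :: "nat \<Rightarrow> real"
  shows "filterlim f at_bot sequentially \<longleftrightarrow> (\<forall>k::nat. \<exists>N. \<forall>n\<ge>N. f n \<le> - real k)"
proof
  assume "filterlim f at_bot sequentially"
  then show "\<forall>k::nat. \<exists>N. \<forall>n\<ge>N. f n \<le> - real k"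
    by (simp add: filterlim_at_bot eventually_sequentially)
next
  assume R: "\<forall>k::nat. \<exists>N. \<forall>n\<ge>N. f n \<le> - real k"
  show "filterlim f at_bot sequentially"
    unfolding filterlim_at_bot eventually_sequentially
  proof
    fix Z :: real
    obtain k :: nat where "- Z \<le> real k"
      using real_arch_simple by blast
    with R show "\<exists>N. \<forall>n\<ge>N. f n \<le> Z"
      by (smt (verit, best))
  qed
qed

text \<open>Beyond some \<open>N\<close> the values are at most 0, and finitely many remain. The
  bound is a natural number so that countably many levels suffice.\<close>

lemma filterlim_at_bot_imp_bounded_above:
  fixes f :: "nat \<Rightarrow> real"
  assumes "filterlim f at_bot sequentially"
  shows "\<exists>L::nat. \<forall>n. f n \<le> real L"
proof -
  obtain N where N: "\<And>n. n \<ge> N \<Longrightarrow> f n \<le> 0"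
    using assms by (auto simp: filterlim_at_bot eventually_sequentially)
  define m where "m = Max (insert 0 (f ` {..<N}))"
  have "f n \<le> m" for n
  proof (cases "n < N")
    case True
    then show ?thesis by (simp add: m_def)
  next
    case False
    then have "f n \<le> 0" using N by simp
    also have "0 \<le> m" by (simp add: m_def)
    finally show ?thesis .
  qed
  moreover obtain L :: nat where "m \<le> real L"
    using real_arch_simple by blast
  ultimately show ?thesis
    by (meson order_trans)
qed

section \<open>Countable unions and i.i.d. sequences\<close>

lemma (in prob_space) ex_prob_pos:
  fixes P :: "nat \<Rightarrow> 'a \<Rightarrow> bool"
  assumes [measurable]: "\<And>n. Measurable.pred M (P n)"
    and pos: "prob {\<omega> \<in> space M. \<exists>n. P n \<omega>} > 0"
  shows "\<exists>n. prob {\<omega> \<in> space M. P n \<omega>} > 0"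
proof (rule ccontr)
  assume "\<not> ?thesis"
  then have "prob {\<omega> \<in> space M. P n \<omega>} = 0" for n
    by (meson measure_nonneg not_less order_antisym)
  then have "AE \<omega> in M. \<not> P n \<omega>" for n
    by (simp add: prob_Collect_eq_0)
  then have "AE \<omega> in M. \<not> (\<exists>n. P n \<omega>)"
    by (simp add: AE_all_countable)
  then have "prob {\<omega> \<in> space M. \<exists>n. P n \<omega>} = 0"
    by (subst prob_Collect_eq_0) auto
  with pos show False by simp
qed

lemma (in prob_space) ex_prob_pos_of_AE_ex:
  fixes P :: "nat \<Rightarrow> 'a \<Rightarrow> bool"
  assumes [measurable]: "\<And>n. Measurable.pred M (P n)"
    and "AE \<omega> in M. \<exists>n. P n \<omega>"
  shows "\<exists>n. prob {\<omega> \<in> space M. P n \<omega>} > 0"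
proof (rule ex_prob_pos)
  have "prob {\<omega> \<in> space M. \<exists>n. P n \<omega>} = 1"
    using assms(2) by (subst prob_Collect_eq_1) auto
  then show "prob {\<omega> \<in> space M. \<exists>n. P n \<omega>} > 0" by simp
qed measurable

lemma (in sequence_space) AE_all_component:
  assumes "AE s in M. P s"
  shows "AE w in S. \<forall>n. P (w n)"
  using AE_component[OF UNIV_I assms] by (simp add: AE_all_countable)

text \<open>By independence, the coordinates \<open>N, ..., n + N\<close> all lie in
  \<open>A\<close> with probability \<open>measure M A ^ Suc n\<close>, which tends to 0.\<close>

lemma (in sequence_space) AE_ex_ge_notin:
  assumes A: "A \<in> sets M" and lt: "measure M A < 1"
  shows "AE w in S. \<exists>n\<ge>N. w n \<notin> A"
proof -
  \<comment> \<open>Coordinates before \<open>N\<close> are unconstrained, so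
    \<open>Pi UNIV E\<close> is the event that the path stays in \<open>A\<close> from
    \<open>N\<close> on.\<close>
  define E where "E i = (if i < N then space M else A)" for i
  have E: "E i \<in> sets M" for i using A by (simp add: E_def)
  have prod: "(\<Prod>i\<le>n + N. measure M (E i)) = measure M A ^ Suc n" for n
  proof -
    have "(\<Prod>i\<le>n + N. measure M (E i)) =
        (\<Prod>i\<in>{..<N}. measure M (E i)) * (\<Prod>i\<in>{N..n + N}. measure M (E i))"
      by (subst prod.union_disjoint[symmetric]) (auto intro!: prod.cong)
    also have "(\<Prod>i\<in>{..<N}. measure M (E i)) = 1"
      by (intro prod.neutral) (simp add: E_def M.prob_space)
    also have "(\<Prod>i\<in>{N..n + N}. measure M (E i)) = (\<Prod>i\<in>{N..n + N}. measure M A)"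
      by (intro prod.cong) (auto simp: E_def)
    finally show ?thesis by simp
  qed
  have "(\<lambda>n. measure M A ^ Suc n) \<longlonglongrightarrow> measure S (Pi UNIV E)"
    using LIMSEQ_ignore_initial_segment[OF measure_PiM_countable[of E], of N] E
    by (simp only: prod)
  moreover have "(\<lambda>n. measure M A ^ Suc n) \<longlonglongrightarrow> 0"
    using lt by (intro LIMSEQ_Suc LIMSEQ_realpow_zero) auto
  ultimately have "measure S (Pi UNIV E) = 0"
    using LIMSEQ_unique by blast
  then have "Pi UNIV E \<in> null_sets S"
    using E by (auto intro!: null_setsI simp: P.emeasure_eq_measure)
  then have "AE w in S. w \<notin> Pi UNIV E"
    by (rule AE_not_in)
  with AE_space show ?thesis
    by eventually_elim (auto simp: E_def space_PiM PiE_iff Pi_iff not_less split: if_splits)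
qed

section \<open>Perturbed walks on the canonical sequence space\<close>

locale real_pair_sequence_space = sequence_space M for M :: "(real \<times> real) measure" +
  assumes sets_M [measurable_cong]: "sets M = sets (borel \<Otimes>\<^sub>M borel)"
begin

lemma space_M [simp]: "space M = UNIV"
  using sets_eq_imp_space_eq[OF sets_M] by (simp add: space_pair_measure)

lemma space_S [simp]: "space S = UNIV"
  by (simp add: space_PiM)

lemma path_value_measurable [measurable]: "(\<lambda>w. path_value w n) \<in> borel_measurable S"
  unfolding path_value_def by measurable

lemma not_divergent_if_nonneg:
  assumes "AE s in M. fst s \<ge> 0"
  shows "\<not> (AE w in S. filterlim (path_value w) at_bot sequentially)"
proof
  assume "AE w in S. filterlim (path_value w) at_bot sequentially"
  \<comment> \<open>A level \<open>- real k\<close> that the perturbation exceeds with positive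
    probability is exceeded infinitely often by independent copies.\<close>
  moreover have "AE s in M. \<exists>k::nat. - real k < snd s"
    by (rule AE_I2) (metis minus_less_iff reals_Archimedean2)
  then obtain k :: nat where k: "measure M {s \<in> space M. - real k < snd s} > 0"
    using M.ex_prob_pos_of_AE_ex[of "\<lambda>k s. - real k < snd s"] by auto
  define A where "A = {s \<in> space M. snd s \<le> - real k}"
  have A[measurable]: "A \<in> sets M" unfolding A_def by measurable
  have "{s \<in> space M. - real k < snd s} = space M - A"
    by (auto simp: A_def)
  with k have "measure M A < 1"
    using M.prob_compl[OF A] by simp
  then have "AE w in S. \<forall>N. \<exists>n\<ge>N. w n \<notin> A"
    using AE_ex_ge_notin[OF A] by (simp add: AE_all_countable)
  moreover have "AE w in S. \<forall>n. fst (w n) \<ge> 0"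
    using AE_all_component[OF assms] .
  ultimately have "AE w in S. False"
  proof eventually_elim
    case (elim w)
    obtain N where N: "\<And>n. n \<ge> N \<Longrightarrow> path_value w n \<le> - real k"
      using elim(1) by (auto simp: filterlim_at_bot_iff_nat)
    obtain n where n: "n \<ge> N" "w n \<notin> A" using elim(2) by blast
    have "path_value w n \<ge> snd (w n)"
      unfolding path_value_def using elim(3) by (simp add: sum_nonneg)
    with N[OF n(1)] n(2) show False
      by (simp add: A_def)
  qed
  then show False
    by (simp add: P.AE_False)
qed

lemma AE_exceeds:
  assumes "AE s in M. fst s < 0 \<longrightarrow> snd s > x"
    and "AE w in S. filterlim (path_value w) at_bot sequentially"
  shows "AE w in S. \<exists>n. path_value w n > x"
proof -
  define A where "A = {s \<in> space M. fst s \<ge> 0 \<and> snd s \<le> x}"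
  have A[measurable]: "A \<in> sets M" unfolding A_def by measurable
  \<comment> \<open>Otherwise all steps would be nonnegative almost surely, contradicting
    divergence.\<close>
  have "measure M A \<noteq> 1"
  proof
    assume "measure M A = 1"
    then have "AE s in M. s \<in> A" by (simp add: M.prob_eq_1)
    then have "AE s in M. fst s \<ge> 0" by eventually_elim (simp add: A_def)
    with assms(2) not_divergent_if_nonneg show False by blast
  qed
  then have "measure M A < 1" using M.prob_le_1[of A] by linarith
  then have "AE w in S. \<exists>n\<ge>0. w n \<notin> A"
    by (rule AE_ex_ge_notin[OF A])
  moreover have "AE w in S. \<forall>n. fst (w n) < 0 \<longrightarrow> snd (w n) > x"
    by (rule AE_all_component[OF assms(1)])
  ultimately show ?thesis
  proof eventually_elim
    case (elim w)
    show ?case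
    proof (rule ccontr)
      assume "\<not> ?thesis"
      then have le: "path_value w n \<le> x" for n by (simp add: not_less)
      \<comment> \<open>Earlier pairs in \<open>A\<close> make the partial sum nonnegative, so the
        perturbation is at most the path value, hence at most \<open>x\<close>; a negative step is
        then excluded.\<close>
      have "w n \<in> A" for n
      proof (induction n rule: less_induct)
        case (less n)
        then have "(\<Sum>k<n. fst (w k)) \<ge> 0"
          by (intro sum_nonneg) (auto simp: A_def)
        with le[of n] have "snd (w n) \<le> x" by (simp add: path_value_def)
        moreover from this have "\<not> fst (w n) < 0" using elim(2) by (meson not_less)
        ultimately show ?case by (simp add: A_def)
      qed
      with elim(1) show False by blast
    qed
  qed
qed

text \<open>Prepending an independent pair preserves the law of the sequence
  (\<open>PiM_iter\<close>). The new first value is at most \<open>x\<close>, and the later ones are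
  old values lowered by more than \<open>c\<close>.\<close>

lemma prob_bounded_step:
  assumes "c \<ge> 0"
  shows "measure M {s. fst s < - c \<and> snd s \<le> x} * measure S {w. \<forall>n. path_value w n \<le> L}
    \<le> measure S {w. \<forall>n. path_value w n \<le> max x (L - c)}"
    (is "measure M ?A * measure S ?B \<le> measure S ?C")
proof -
  interpret MS: pair_prob_space M S ..
  have "{s \<in> space M. fst s < - c \<and> snd s \<le> x} \<in> sets M"
    "{w \<in> space S. \<forall>n. path_value w n \<le> L} \<in> sets S"
    "{w \<in> space S. \<forall>n. path_value w n \<le> max x (L - c)} \<in> sets S"
    by measurable
  then have [measurable]: "?A \<in> sets M" "?B \<in> sets S" "?C \<in> sets S"
    by simp_all
  have "measure M ?A * measure S ?B = measure (M \<Otimes>\<^sub>M S) (?A \<times> ?B)"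
    by (simp add: measure_def P.emeasure_pair_measure_Times enn2real_mult)
  also have "\<dots> \<le> measure (M \<Otimes>\<^sub>M S) ((\<lambda>(s, w). case_nat s w) -` ?C \<inter> space (M \<Otimes>\<^sub>M S))"
  proof (rule MS.P.finite_measure_mono)
    show "?A \<times> ?B \<subseteq> (\<lambda>(s, w). case_nat s w) -` ?C \<inter> space (M \<Otimes>\<^sub>M S)"
    proof (clarsimp simp: space_pair_measure)
      fix a b w n
      assume "a < - c" "b \<le> x" "\<forall>n. path_value w n \<le> L"
      then show "path_value (case_nat (a, b) w) n \<le> max x (L - c)"
        by (cases n) (auto simp: le_max_iff_disj intro!: disjI2 dest!: spec[of _ "n - 1"])
    qed
  qed measurable
  also have "\<dots> = measure (distr (M \<Otimes>\<^sub>M S) S (\<lambda>(s, w). case_nat s w)) ?C"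
    by (subst measure_distr) simp_all
  also have "\<dots> = measure S ?C"
    by (simp only: PiM_iter)
  finally show ?thesis .
qed

lemma prob_bounded_pos:
  assumes pos: "measure M {s. fst s < 0 \<and> snd s \<le> x} > 0"
    and div: "AE w in S. filterlim (path_value w) at_bot sequentially"
  shows "measure S {w. \<forall>n. path_value w n \<le> x} > 0"
proof -
  let ?Q = "\<lambda>L. measure S {w. \<forall>n. path_value w n \<le> L}"
  \<comment> \<open>The event of a negative step is a countable union of events with steps below a
    fixed negative number; one of them, with perturbation at most \<open>x\<close>, has positive
    probability and supplies \<open>c\<close>.\<close>
  have "(\<exists>k. a < - inverse (real (Suc k))) \<longleftrightarrow> a < 0" for a :: real
  proof
    assume "\<exists>k. a < - inverse (real (Suc k))"
    then show "a < 0"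
      by (meson inverse_positive_iff_positive neg_less_0_iff_less of_nat_0_less_iff order_less_trans zero_less_Suc)
  next
    assume "a < 0"
    then show "\<exists>k. a < - inverse (real (Suc k))"
      using reals_Archimedean[of "- a"] by (metis less_minus_iff neg_0_less_iff_less)
  qed
  then obtain k where k: "measure M {s. fst s < - inverse (real (Suc k)) \<and> snd s \<le> x} > 0"
    using M.ex_prob_pos[of "\<lambda>k s. fst s < - inverse (real (Suc k)) \<and> snd s \<le> x"] pos
    by (auto simp del: of_nat_Suc)
  define c where "c = inverse (real (Suc k))"
  have c: "c > 0" by (simp add: c_def)
  have "AE w in S. \<exists>L::nat. \<forall>n. path_value w n \<le> real L"
    using div by eventually_elim (rule filterlim_at_bot_imp_bounded_above)
  then obtain L :: nat where L: "?Q (real L) > 0"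
    using P.ex_prob_pos_of_AE_ex[of "\<lambda>L w. \<forall>n. path_value w n \<le> real L"] by auto
  have step: "?Q (max x (y - c)) > 0" if "?Q y > 0" for y
    using prob_bounded_step[of c x y] c k that mult_pos_pos unfolding c_def[symmetric]
    by (smt (verit))
  have iter: "?Q (max x (real L - real m * c)) > 0" for m
  proof (induction m)
    case 0
    have "?Q (real L) \<le> ?Q (max x (real L))"
    proof (rule P.finite_measure_mono)
      have "{w \<in> space S. \<forall>n. path_value w n \<le> max x (real L)} \<in> sets S" by measurable
      then show "{w. \<forall>n. path_value w n \<le> max x (real L)} \<in> sets S" by simp
    qed (auto simp: le_max_iff_disj)
    with L show ?case by simp
  next
    case (Suc m)
    \<comment> \<open>Since \<open>c > 0\<close>, the term \<open>x - c\<close> is absorbed by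
      \<open>x\<close>.\<close>
    have "max x (max x (real L - real m * c) - c) = max x (real L - real (Suc m) * c)"
      using c by (simp add: max_def algebra_simps)
    with step[OF Suc.IH] show ?case by simp
  qed
  \<comment> \<open>With this many steps the level \<open>L\<close> has dropped below
    \<open>x\<close>, and only \<open>x\<close> survives in the maximum.\<close>
  obtain m :: nat where "real L - x < real m * c"
    using ex_less_of_nat_mult[OF c] by blast
  then have "max x (real L - real m * c) = x" by simp
  with iter[of m] show ?thesis by simp
qed

lemma AE_exceeds_iff:
  assumes div: "AE w in S. filterlim (path_value w) at_bot sequentially"
  shows "(AE w in S. \<exists>n. path_value w n > x) \<longleftrightarrow> measure M {s. fst s < 0 \<and> snd s \<le> x} = 0"
proof -
  have "{w \<in> space S. \<forall>n. path_value w n \<le> x} \<in> sets S"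
    by measurable
  then have S_iff: "measure S {w. \<forall>n. path_value w n \<le> x} = 0 \<longleftrightarrow> (AE w in S. \<exists>n. path_value w n > x)"
    using P.prob_Collect_eq_0[of "\<lambda>w. \<forall>n. path_value w n \<le> x"] by (simp add: not_le)
  have "{s \<in> space M. fst s < 0 \<and> snd s \<le> x} \<in> sets M"
    by measurable
  then have M_iff: "measure M {s. fst s < 0 \<and> snd s \<le> x} = 0 \<longleftrightarrow> (AE s in M. fst s < 0 \<longrightarrow> snd s > x)"
    using M.prob_Collect_eq_0[of "\<lambda>s. fst s < 0 \<and> snd s \<le> x"] by (simp add: not_le)
  show ?thesis
  proof
    assume "AE w in S. \<exists>n. path_value w n > x"
    then have "\<not> measure S {w. \<forall>n. path_value w n \<le> x} > 0"
      using S_iff by linarith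
    then have "\<not> measure M {s. fst s < 0 \<and> snd s \<le> x} > 0"
      using prob_bounded_pos[OF _ div] by blast
    then show "measure M {s. fst s < 0 \<and> snd s \<le> x} = 0"
      by (simp add: zero_less_measure_iff)
  next
    assume "measure M {s. fst s < 0 \<and> snd s \<le> x} = 0"
    then show "AE w in S. \<exists>n. path_value w n > x"
      using M_iff AE_exceeds[OF _ div] by blast
  qed
qed

text \<open>If the perturbation were almost surely at most \<open>x\<close>, the null event would
  force nonnegative steps, which divergence rules out.\<close>

lemma prob_perturbation_le_less_1:
  assumes div: "AE w in S. filterlim (path_value w) at_bot sequentially"
    and null: "measure M {s. fst s < 0 \<and> snd s \<le> x} = 0"
  shows "measure M {s. snd s \<le> x} < 1"
proof (rule ccontr)
  have "{s \<in> space M. fst s < 0 \<and> snd s \<le> x} \<in> sets M"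
    by measurable
  then have "AE s in M. \<not> (fst s < 0 \<and> snd s \<le> x)"
    using null M.prob_Collect_eq_0[of "\<lambda>s. fst s < 0 \<and> snd s \<le> x"] by simp
  moreover assume "\<not> ?thesis"
  then have "measure M {s. snd s \<le> x} = 1"
    using M.prob_le_1 by (meson not_less order_antisym)
  moreover have "{s \<in> space M. snd s \<le> x} \<in> sets M"
    by measurable
  ultimately have "AE s in M. snd s \<le> x"
    using M.prob_Collect_eq_1[of "\<lambda>s. snd s \<le> x"] by simp
  with \<open>AE s in M. \<not> (fst s < 0 \<and> snd s \<le> x)\<close> have "AE s in M. fst s \<ge> 0"
    by eventually_elim auto
  with div not_divergent_if_nonneg show False by blast
qed

end

section \<open>Transfer to the canonical sequence space\<close>

context perturbed_random_walk
begin

definition step_distr :: "(real \<times> real) measure"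
  where "step_distr = distr M borel (\<lambda>\<omega>. (\<xi> \<omega>, \<eta> \<omega>))"

text \<open>The shift skips index 0, where the family keeps the generic pair.\<close>

definition step_path :: "'a \<Rightarrow> nat \<Rightarrow> real \<times> real"
  where "step_path \<omega> n = (\<xi>s (Suc n) \<omega>, \<eta>s (Suc n) \<omega>)"

lemma pair_family_measurable [measurable]: "pair_family \<xi> \<eta> \<xi>s \<eta>s n \<in> borel_measurable M"
  using indep by (simp add: indep_vars_def)

lemma step_measurable [measurable]: "(\<lambda>\<omega>. (\<xi> \<omega>, \<eta> \<omega>)) \<in> borel_measurable M"
  using pair_family_measurable[of 0] by (simp add: pair_family_def)

lemma step_path_component_measurable [measurable]: "(\<lambda>\<omega>. step_path \<omega> n) \<in> borel_measurable M"
  using pair_family_measurable[of "Suc n"] by (simp add: pair_family_def step_path_def)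

lemma real_pair_sequence_space_step_distr: "real_pair_sequence_space step_distr"
proof -
  interpret D: prob_space step_distr
    unfolding step_distr_def by (rule prob_space_distr) measurable
  interpret product_prob_space "\<lambda>i. step_distr" "UNIV :: nat set" ..
  show ?thesis
    by unfold_locales (simp only: step_distr_def sets_distr borel_prod)
qed

lemma step_path_measurable [measurable]:
  "step_path \<in> M \<rightarrow>\<^sub>M (\<Pi>\<^sub>M i\<in>UNIV. step_distr)"
proof -
  have "(\<lambda>\<omega>. \<lambda>n\<in>UNIV. step_path \<omega> n) \<in> M \<rightarrow>\<^sub>M (\<Pi>\<^sub>M i\<in>UNIV. step_distr)"
    by (rule measurable_restrict) (simp add: step_distr_def)
  then show ?thesis by (simp add: restrict_UNIV)
qed

text \<open>Independence makes the joint law of the whole family a product; dropping coordinate 0 is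
  a reindexing along the injection \<open>Suc\<close>, which preserves a product of equal
  factors.\<close>

lemma distr_step_path:
  "distr M (\<Pi>\<^sub>M i\<in>UNIV. step_distr) step_path = (\<Pi>\<^sub>M i\<in>UNIV. step_distr)"
proof -
  let ?X = "pair_family \<xi> \<eta> \<xi>s \<eta>s"
  interpret D: real_pair_sequence_space step_distr
    by (rule real_pair_sequence_space_step_distr)
  \<comment> \<open>The measures \<open>borel\<close> and \<open>step_distr\<close> have the same
    measurable sets, so either may serve as target of the law.\<close>
  have sets: "sets (\<Pi>\<^sub>M i\<in>UNIV::nat set. step_distr) = sets (\<Pi>\<^sub>M i\<in>UNIV::nat set. borel)"
    by (intro sets_PiM_cong) (simp_all add: step_distr_def)
  have "distr M borel (?X n) = step_distr" for n
    using ident_distr[of n] by (cases "n = 0") (simp_all add: pair_family_def step_distr_def)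
  then have "distr M (\<Pi>\<^sub>M i\<in>UNIV. borel) (\<lambda>\<omega>. \<lambda>i\<in>UNIV. ?X i \<omega>) = (\<Pi>\<^sub>M i\<in>UNIV. step_distr)"
    using indep_vars_iff_distr_eq_PiM[where I=UNIV and M'="\<lambda>_. borel" and X="?X"] indep by simp
  then have X: "distr M D.S (\<lambda>\<omega> i. ?X i \<omega>) = D.S"
    using sets by (simp add: restrict_UNIV cong: distr_cong)
  have [measurable]: "(\<lambda>\<omega> i. ?X i \<omega>) \<in> M \<rightarrow>\<^sub>M D.S"
  proof -
    have "(\<lambda>\<omega>. \<lambda>n\<in>UNIV. ?X n \<omega>) \<in> M \<rightarrow>\<^sub>M D.S"
      by (rule measurable_restrict) (simp add: step_distr_def)
    then show ?thesis by (simp add: restrict_UNIV)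
  qed
  have [measurable]: "(\<lambda>w n. w (Suc n)) \<in> D.S \<rightarrow>\<^sub>M D.S"
  proof -
    have "(\<lambda>w. \<lambda>n\<in>UNIV. w (Suc n)) \<in> D.S \<rightarrow>\<^sub>M D.S"
      by measurable
    then show ?thesis by (simp add: restrict_UNIV)
  qed
  have "distr M D.S step_path = distr (distr M D.S (\<lambda>\<omega> i. ?X i \<omega>)) D.S (\<lambda>w n. w (Suc n))"
    by (simp add: distr_distr comp_def) (simp add: pair_family_def step_path_def[abs_def])
  also have "\<dots> = distr D.S D.S (\<lambda>w n. w (Suc n))"
    by (simp only: X)
  also have "\<dots> = D.S"
    using distr_PiM_reindex[of UNIV "\<lambda>_. step_distr" Suc UNIV] D.M.prob_space_axioms
    by (simp add: restrict_UNIV)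
  finally show ?thesis .
qed

text \<open>An almost sure property of the path depends only on its law, which is the product
  measure.\<close>

lemma AE_step_path_iff:
  assumes "Measurable.pred (\<Pi>\<^sub>M i\<in>UNIV. step_distr) P"
  shows "(AE \<omega> in M. P (step_path \<omega>)) \<longleftrightarrow> (AE w in (\<Pi>\<^sub>M i\<in>UNIV. step_distr). P w)"
  using AE_distr_iff[OF step_path_measurable, of P] assms
  unfolding distr_step_path pred_def by blast

lemma perturbed_walk_Suc_step_path:
  "perturbed_walk \<xi>s \<eta>s (Suc n) \<omega> = path_value (step_path \<omega>) n"
  by (simp add: perturbed_walk_Suc step_path_def[abs_def])

lemma AE_first_passage_finite_iff:
  "(AE \<omega> in M. first_passage (perturbed_walk \<xi>s \<eta>s) x \<omega> < \<infinity>) \<longleftrightarrow>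
    (AE w in (\<Pi>\<^sub>M i\<in>UNIV. step_distr). \<exists>n. path_value w n > x)"
proof -
  interpret D: real_pair_sequence_space step_distr
    by (rule real_pair_sequence_space_step_distr)
  show ?thesis
    unfolding first_passage_finite_iff perturbed_walk_Suc_step_path
    by (rule AE_step_path_iff) measurable
qed

lemma negatively_divergent_iff:
  "negatively_divergent M (perturbed_walk \<xi>s \<eta>s) \<longleftrightarrow>
    (AE w in (\<Pi>\<^sub>M i\<in>UNIV. step_distr). filterlim (path_value w) at_bot sequentially)"
proof -
  interpret D: real_pair_sequence_space step_distr
    by (rule real_pair_sequence_space_step_distr)
  have shift: "filterlim (\<lambda>n. perturbed_walk \<xi>s \<eta>s n \<omega>) at_bot sequentially \<longleftrightarrow>
      filterlim (path_value (step_path \<omega>)) at_bot sequentially" for \<omega>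
    \<comment> \<open>The meaningless value at index 0 does not affect the limit.\<close>
    using filterlim_sequentially_Suc[of "\<lambda>n. perturbed_walk \<xi>s \<eta>s n \<omega>" at_bot]
    by (simp add: perturbed_walk_Suc_step_path)
  show ?thesis
    unfolding negatively_divergent_def shift filterlim_at_bot_iff_nat
    by (rule AE_step_path_iff) measurable
qed

lemma measure_step_distr:
  assumes "Measurable.pred borel P"
  shows "measure step_distr {s. P s} = prob {\<omega> \<in> space M. P (\<xi> \<omega>, \<eta> \<omega>)}"
  using assms unfolding step_distr_def
  by (subst measure_distr) (auto simp: pred_def intro!: arg_cong[where f=prob])

end

theorem theorem2p3:
  fixes M :: "'a measure" and \<xi> \<eta> :: "'a \<Rightarrow> real"
    and \<xi>s \<eta>s :: "nat \<Rightarrow> 'a \<Rightarrow> real" and x :: real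
  assumes "perturbed_random_walk M \<xi> \<eta> \<xi>s \<eta>s"
    and "negatively_divergent M (perturbed_walk \<xi>s \<eta>s)"
  shows "((AE \<omega> in M. first_passage (perturbed_walk \<xi>s \<eta>s) x \<omega> < \<infinity>) \<longleftrightarrow>
            measure M {\<omega> \<in> space M. \<xi> \<omega> < 0 \<and> \<eta> \<omega> \<le> x} = 0) \<and>
         ((AE \<omega> in M. first_passage (perturbed_walk \<xi>s \<eta>s) x \<omega> < \<infinity>) \<longrightarrow>
            measure M {\<omega> \<in> space M. \<eta> \<omega> \<le> x} < 1)"
proof -
  interpret perturbed_random_walk M \<xi> \<eta> \<xi>s \<eta>s by fact
  interpret D: real_pair_sequence_space step_distr
    by (rule real_pair_sequence_space_step_distr)
  have div: "AE w in D.S. filterlim (path_value w) at_bot sequentially"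
    using assms(2) by (simp add: negatively_divergent_iff)
  \<comment> \<open>Reading \<open>borel\<close> on pairs as a product sigma-algebra makes the
    projections measurable.\<close>
  have "measure step_distr {s. fst s < 0 \<and> snd s \<le> x} =
      measure M {\<omega> \<in> space M. \<xi> \<omega> < 0 \<and> \<eta> \<omega> \<le> x}"
    by (subst measure_step_distr) (simp_all add: borel_prod[symmetric])
  moreover have "measure step_distr {s. snd s \<le> x} = measure M {\<omega> \<in> space M. \<eta> \<omega> \<le> x}"
    by (subst measure_step_distr) (simp_all add: borel_prod[symmetric])
  ultimately show ?thesis
    using D.AE_exceeds_iff[OF div, of x] D.prob_perturbation_le_less_1[OF div, of x]
    unfolding AE_first_passage_finite_iff by simp
qed

end
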